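(* Let $k\in\mathbb N_+$, let $\mathbb V^k$ be either $\mathbb P^k$ or $\mathbb Q^k$, let $\theta\in[-1,1]$, and consider a feasible symmetric CAD for $(\theta,\mathbb V^k)$ with boundary weight $\overline\omega$: $$\langle p\rangle_\Omega=\overline\omega\big[(1+\theta)\langle p\rangle_\Omega^x+(1-\theta)\langle p\rangle_\Omega^y\big]+\sum_{s=1}^S\omega_s\,\overline{p(x^{(s)},y^{(s)})}\qquad\forall p\in\mathbb V^k .$$ If $\overline\omega=\phi^\star(\theta,\mathbb V^k_+)$, then $\overline\omega_\star(\theta,\mathbb V^k)=\phi^\star(\theta,\mathbb V^k_+)$ and this CAD is a symmetric OCAD for $\mathbb V^k$ (and this $\theta$).
   Context: $\mathbb P^k$: real polynomials in $(x,y)$ of total degree at most $k$; $\mathbb Q^k$: real polynomials of degree at most $k$ in each variable. $\Omega=[-1,1]^2$, $\langle p\rangle_\Omega=\frac14\iint_\Omega p$, $\langle p\rangle_\Omega^x=\frac14\int_{-1}^1[p(-1,y)+p(1,y)]dy$, $\langle p\rangle_\Omega^y=\frac14\int_{-1}^1[p(x,-1)+p(x,1)]dx$, $\overline{p(a,b)}=\frac14[p(a,b)+p(-a,b)+p(a,-b)+p(-a,-b)]$. A feasible symmetric CAD for $(\theta,\mathbb V^k)$ with boundary weight $\overline\omega$ is an identity of the displayed form, valid for all $p\in\mathbb V^k$, with $S\ge 0$ finite, $\overline\omega>0$, all $\omega_s>0$ and all $(x^{(s)},y^{(s)})\in[0,1]^2$. $\overline\omega_\star(\theta,\mathbb V^k)$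 is the maximum of $\overline\omega$ over all such CADs (for the fixed $\theta$), and a symmetric OCAD is one attaining it. $\mathbb V^k_+=\{p\in\mathbb V^k:p\ge0\text{ on }\Omega\}$. For $p\in\mathbb V^k_+$, $\phi(p;\theta)=\dfrac{\langle p\rangle_\Omega}{(1+\theta)\langle p\rangle_\Omega^x+(1-\theta)\langle p\rangle_\Omega^y}$ if the denominator is nonzero, and $\phi(p;\theta)=+\infty$ otherwise; $\phi^\star(\theta,\mathbb V^k_+)=\inf_{p\in\mathbb V^k_+}\phi(p;\theta)$. *)

theory Defs
  imports "HOL-Analysis.Analysis" "HOL-Computational_Algebra.Polynomial"
begin

text \<open>
  A polynomial in \<open>(x, y)\<close> is a \<^typ>\<open>real poly poly\<close>: the outer variable is \<open>y\<close>, and the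
  coefficients are polynomials in \<open>x\<close>.  So \<open>coeff (coeff p j) i\<close> is the coefficient of
  \<open>x ^ i * y ^ j\<close>, as \<open>eval2_altdef\<close> confirms.
\<close>

type_synonym bipoly = "real poly poly"

definition eval2 :: "bipoly \<Rightarrow> real \<Rightarrow> real \<Rightarrow> real" where
  "eval2 p x y = poly (poly p [:y:]) x"

lemma eval2_altdef:
  "eval2 p x y =
     (\<Sum>j\<le>degree p. \<Sum>i\<le>degree (coeff p j). coeff (coeff p j) i * x ^ i * y ^ j)"
proof -
  have "eval2 p x y = (\<Sum>j\<le>degree p. poly (coeff p j) x * y ^ j)"
    by (simp add: eval2_def poly_altdef[of p] poly_sum)
  also have "\<dots> = (\<Sum>j\<le>degree p. \<Sum>i\<le>degree (coeff p j).
                   coeff (coeff p j) i * x ^ i * y ^ j)"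
    by (simp add: poly_altdef[of _ x] sum_distrib_right)
  finally show ?thesis .
qed

definition P_space :: "nat \<Rightarrow> bipoly set" where
  "P_space k = {p. \<forall>i j. coeff (coeff p j) i \<noteq> 0 \<longrightarrow> i + j \<le> k}"

definition Q_space :: "nat \<Rightarrow> bipoly set" where
  "Q_space k = {p. \<forall>i j. coeff (coeff p j) i \<noteq> 0 \<longrightarrow> i \<le> k \<and> j \<le> k}"

definition Omega :: "(real \<times> real) set" where
  "Omega = {-1..1} \<times> {-1..1}"

definition cell_avg :: "bipoly \<Rightarrow> real" where
  "cell_avg p = 1/4 * integral Omega (\<lambda>(x, y). eval2 p x y)"

definition edge_avg_x :: "bipoly \<Rightarrow> real" where
  "edge_avg_x p = 1/4 * integral {-1..1} (\<lambda>y. eval2 p (-1) y + eval2 p 1 y)"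

definition edge_avg_y :: "bipoly \<Rightarrow> real" where
  "edge_avg_y p = 1/4 * integral {-1..1} (\<lambda>x. eval2 p x (-1) + eval2 p x 1)"

definition boundary_avg :: "real \<Rightarrow> bipoly \<Rightarrow> real" where
  "boundary_avg \<theta> p = (1 + \<theta>) * edge_avg_x p + (1 - \<theta>) * edge_avg_y p"

definition sym_avg :: "bipoly \<Rightarrow> real \<Rightarrow> real \<Rightarrow> real" where
  "sym_avg p a b =
     1/4 * (eval2 p a b + eval2 p (-a) b + eval2 p a (-b) + eval2 p (-a) (-b))"

text \<open>
  \<open>wbar\<close> is the boundary weight.  The interior nodes are \<open>(X s, Y s)\<close> with weights \<open>w s\<close>
  for \<open>1 \<le> s \<le> S\<close>; values of \<open>w\<close>, \<open>X\<close>, \<open>Y\<close> at other indices are irrelevant.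
\<close>

definition feasible_sym_CAD ::
    "real \<Rightarrow> bipoly set \<Rightarrow> real \<Rightarrow> nat \<Rightarrow> (nat \<Rightarrow> real) \<Rightarrow> (nat \<Rightarrow> real) \<Rightarrow> (nat \<Rightarrow> real) \<Rightarrow> bool"
  where
  "feasible_sym_CAD \<theta> V wbar S w X Y \<longleftrightarrow>
     wbar > 0 \<and>
     (\<forall>s\<in>{1..S}. w s > 0 \<and> X s \<in> {0..1} \<and> Y s \<in> {0..1}) \<and>
     (\<forall>p\<in>V. cell_avg p =
        wbar * boundary_avg \<theta> p + (\<Sum>s=1..S. w s * sym_avg p (X s) (Y s)))"

definition feasible_weights :: "real \<Rightarrow> bipoly set \<Rightarrow> real set" where
  "feasible_weights \<theta> V = {wbar. \<exists>S w X Y. feasible_sym_CAD \<theta> V wbar S w X Y}"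

text \<open>\<^const>\<open>Greatest\<close> is the maximum when one exists and is unspecified otherwise.\<close>

definition omega_star :: "real \<Rightarrow> bipoly set \<Rightarrow> real" where
  "omega_star \<theta> V = (GREATEST wbar. wbar \<in> feasible_weights \<theta> V)"

text \<open>
  Attaining the maximum is stated as an upper bound, not only as equality with
  \<^const>\<open>omega_star\<close>, so that it also asserts that the maximum exists.
\<close>

definition sym_OCAD ::
    "real \<Rightarrow> bipoly set \<Rightarrow> real \<Rightarrow> nat \<Rightarrow> (nat \<Rightarrow> real) \<Rightarrow> (nat \<Rightarrow> real) \<Rightarrow> (nat \<Rightarrow> real) \<Rightarrow> bool"
  where
  "sym_OCAD \<theta> V wbar S w X Y \<longleftrightarrow>
     feasible_sym_CAD \<theta> V wbar S w X Y \<and>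
     wbar = omega_star \<theta> V \<and>
     (\<forall>wbar'\<in>feasible_weights \<theta> V. wbar' \<le> wbar)"

definition nonneg_part :: "bipoly set \<Rightarrow> bipoly set" where
  "nonneg_part V = {p \<in> V. \<forall>(x, y)\<in>Omega. eval2 p x y \<ge> 0}"

definition phi :: "bipoly \<Rightarrow> real \<Rightarrow> ereal" where
  "phi p \<theta> =
     (if boundary_avg \<theta> p \<noteq> 0 then ereal (cell_avg p / boundary_avg \<theta> p) else \<infinity>)"

definition phi_star :: "real \<Rightarrow> bipoly set \<Rightarrow> ereal" where
  "phi_star \<theta> Vp = (INF p\<in>Vp. phi p \<theta>)"

end

theory Submission
  imports Defs
begin

text \<open>
  On a nonnegative \<open>p\<close> the interior nodes of a CAD contribute a nonnegative amount, so dropping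
  them shows that its boundary weight is at most \<open>\<phi>(p; \<theta>)\<close>.  Hence \<open>\<phi>\<^sup>\<star>\<close> bounds every feasible
  boundary weight, and a CAD reaching this bound is optimal.
\<close>

text \<open>The reflections of a node of the unit square in the two axes stay in
  \<open>Omega\<close>, so all four averaged values are nonnegative.\<close>

lemma sym_avg_nonneg:
  assumes "p \<in> nonneg_part V" "a \<in> {0..1}" "b \<in> {0..1}"
  shows "sym_avg p a b \<ge> 0"
proof -
  have "eval2 p x y \<ge> 0" if "x \<in> {-1..1}" "y \<in> {-1..1}" for x y
    using assms(1) that by (auto simp: nonneg_part_def Omega_def)
  then show ?thesis
    using assms(2,3) by (simp add: sym_avg_def)
qed

lemma edge_avg_nonneg:
  assumes "p \<in> nonneg_part V"
  shows "edge_avg_x p \<ge> 0" "edge_avg_y p \<ge> 0"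
proof -
  have nonneg: "eval2 p x y \<ge> 0" if "x \<in> {-1..1}" "y \<in> {-1..1}" for x y
    using assms that by (auto simp: nonneg_part_def Omega_def)
  \<comment> \<open>The case split avoids proving integrability of the edge traces:
    \<open>integral\<close> is 0 by convention on a non-integrable function.\<close>
  have int_nonneg: "integral {-1..1} f \<ge> 0" if "\<And>t. t \<in> {-1..1} \<Longrightarrow> f t \<ge> 0" for f :: "real \<Rightarrow> real"
    using that by (cases "f integrable_on {-1..1}")
      (auto intro: integral_nonneg simp: not_integrable_integral)
  show "edge_avg_x p \<ge> 0"
    unfolding edge_avg_x_def
    by (intro mult_nonneg_nonneg int_nonneg add_nonneg_nonneg nonneg) auto
  show "edge_avg_y p \<ge> 0"
    unfolding edge_avg_y_def
    by (intro mult_nonneg_nonneg int_nonneg add_nonneg_nonneg nonneg) auto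
qed

text \<open>The range of \<open>\<theta>\<close> makes both factors \<open>1 + \<theta>\<close> and
  \<open>1 - \<theta>\<close> nonnegative.\<close>

lemma boundary_avg_nonneg:
  assumes "p \<in> nonneg_part V" "\<theta> \<in> {-1..1}"
  shows "boundary_avg \<theta> p \<ge> 0"
  using assms edge_avg_nonneg[OF assms(1)] by (simp add: boundary_avg_def)

text \<open>This is weak duality: every nonnegative \<open>p\<close> certifies an upper bound on the
  weight of every CAD.\<close>

lemma feasible_sym_CAD_le_phi:
  assumes "feasible_sym_CAD \<theta> V wbar S w X Y" "\<theta> \<in> {-1..1}" "p \<in> nonneg_part V"
  shows "ereal wbar \<le> phi p \<theta>"
proof (cases "boundary_avg \<theta> p = 0")
  case True
  then show ?thesis by (simp add: phi_def)
next
  case False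
  \<comment> \<open>A strictly positive denominator keeps the direction of the inequality in the
    final division.\<close>
  then have pos: "boundary_avg \<theta> p > 0"
    using boundary_avg_nonneg[OF assms(3,2)] by simp
  have node: "w s > 0 \<and> X s \<in> {0..1} \<and> Y s \<in> {0..1}" if "s \<in> {1..S}" for s
    using assms(1) that unfolding feasible_sym_CAD_def by blast
  have "(\<Sum>s=1..S. w s * sym_avg p (X s) (Y s)) \<ge> 0"
    using node sym_avg_nonneg[OF assms(3)] by (intro sum_nonneg mult_nonneg_nonneg) (auto simp: less_imp_le)
  moreover have "p \<in> V"
    using assms(3) by (simp add: nonneg_part_def)
  ultimately have "wbar * boundary_avg \<theta> p \<le> cell_avg p"
    using assms(1) by (simp add: feasible_sym_CAD_def)
  then show ?thesis
    using pos by (simp add: phi_def pos_le_divide_eq)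
qed

lemma feasible_weights_le_phi_star:
  assumes "wbar \<in> feasible_weights \<theta> V" "\<theta> \<in> {-1..1}"
  shows "ereal wbar \<le> phi_star \<theta> (nonneg_part V)"
  using assms feasible_sym_CAD_le_phi
  by (auto simp: feasible_weights_def phi_star_def intro!: INF_greatest)

theorem theorem3p24:
  fixes k :: nat and V :: "bipoly set" and \<theta> wbar :: real
    and S :: nat and w X Y :: "nat \<Rightarrow> real"
  assumes "k \<ge> 1"
    and "V = P_space k \<or> V = Q_space k"
    and "\<theta> \<in> {-1..1}"
    and "feasible_sym_CAD \<theta> V wbar S w X Y"
    and "ereal wbar = phi_star \<theta> (nonneg_part V)"
  shows "ereal (omega_star \<theta> V) = phi_star \<theta> (nonneg_part V) \<and>
         sym_OCAD \<theta> V wbar S w X Y"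
proof -
  have feasible: "wbar \<in> feasible_weights \<theta> V"
    using assms(4) by (auto simp: feasible_weights_def)
  \<comment> \<open>Rewriting the infimum as \<open>ereal wbar\<close> turns the extended-real bound
    into one between reals.\<close>
  have max: "wbar' \<le> wbar" if "wbar' \<in> feasible_weights \<theta> V" for wbar'
    using feasible_weights_le_phi_star[OF that assms(3)] assms(5)[symmetric] by simp
  \<comment> \<open>Since \<open>wbar\<close> is both a member and an upper bound, the maximum
    exists and \<open>GREATEST\<close> takes its intended value.\<close>
  have "omega_star \<theta> V = wbar"
    unfolding omega_star_def using feasible max by (rule Greatest_equality)
  with assms(4,5) max show ?thesis
    by (simp add: sym_OCAD_def)
qed

end
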